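(* Let $k\ge 2$ and $P=\{A^k+B^k\mid A,B\in M_2(\mathbb F_3)\}$. Let $C_5$ be the set of nonzero nilpotent matrices in $M_2(\mathbb F_3)$ (the conjugacy class of $\begin{pmatrix}0&1\\0&0\end{pmatrix}$), and let $C_9,C_{10},C_{12}$ be the conjugacy classes in $M_2(\mathbb F_3)$ of $\begin{pmatrix}2&1\\0&2\end{pmatrix}$, $\begin{pmatrix}0&2\\1&0\end{pmatrix}$, $\begin{pmatrix}0&1\\1&1\end{pmatrix}$ respectively. Then $P=M_2(\mathbb F_3)$ if $k\not\equiv 0,6,12,18\pmod{24}$; $P=M_2(\mathbb F_3)\setminus C_5$ if $k\equiv 6$ or $18\pmod{24}$; and $P=M_2(\mathbb F_3)\setminus(C_5\cup C_9\cup C_{10}\cup C_{12})$ if $k\equiv 0\pmod{12}$. *)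

theory Defs
  imports "Jordan_Normal_Form.Matrix" "HOL-Library.Cardinality"
begin

definition mat2 :: "'a \<Rightarrow> 'a \<Rightarrow> 'a \<Rightarrow> 'a \<Rightarrow> 'a mat" where
  "mat2 a b c d = mat_of_rows_list 2 [[a, b], [c, d]]"

definition conj_class :: "'a :: semiring_1 mat \<Rightarrow> 'a mat set" where
  "conj_class A = {B. similar_mat B A}"

definition nilpotent_mat :: "'a :: semiring_1 mat \<Rightarrow> bool" where
  "nilpotent_mat A \<longleftrightarrow> square_mat A \<and> (\<exists>n. A ^\<^sub>m n = 0\<^sub>m (dim_row A) (dim_col A))"

definition sums_of_two_powers :: "nat \<Rightarrow> nat \<Rightarrow> 'a :: semiring_1 mat set" where
  "sums_of_two_powers n k =
     {A ^\<^sub>m k + B ^\<^sub>m k | A B. A \<in> carrier_mat n n \<and> B \<in> carrier_mat n n}"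

end

theory Submission
  imports Defs
begin

text \<open>
  A non-scalar 2x2 matrix is similar to the companion matrix of its characteristic polynomial, and
  being a sum of two k-th powers is invariant under similarity, so only the scalar matrices and nine
  companion matrices matter. Idempotents are k-th powers for every k > 0, and sums of two of them
  reach the scalars and five of the companion matrices. The elements of order 3 are k-th powers if 3
  does not divide k, those of order 4 if 4 does not divide k, and the negatives of idempotents if k
  is odd; adding an idempotent or another such element gives the remaining companion matrices unless
  12 divides k, or 6 divides k in the nilpotent case. Conversely, a 6th power is scalar, an
  idempotent of trace 1, or has trace 0 and determinant 1, and for 12th powers the last alternative
  disappears.
\<close>

section \<open>Explicit 2x2 matrices\<close>

lemma mat2_eq_mat:
  "mat2 a b c d = mat 2 2 (\<lambda>(i, j). if i = 0 then if j = 0 then a else b else if j = 0 then c else d)"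
  by (rule eq_matI) (auto simp: mat2_def mat_of_rows_list_def numeral_2_eq_2 less_Suc_eq)

lemma mat2_carrier [simp]: "mat2 a b c d \<in> carrier_mat 2 2"
  by (simp add: mat2_eq_mat)

lemma dim_mat2 [simp]: "dim_row (mat2 a b c d) = 2" "dim_col (mat2 a b c d) = 2"
  by (simp_all add: mat2_eq_mat)

lemma mat2_eq_iff [simp]:
  "mat2 a b c d = mat2 a' b' c' d' \<longleftrightarrow> a = a' \<and> b = b' \<and> c = c' \<and> d = d'"
proof
  assume *: "mat2 a b c d = mat2 a' b' c' d'"
  have "mat2 a b c d $$ (i, j) = mat2 a' b' c' d' $$ (i, j)" for i j
    using * by simp
  from this[of 0 0] this[of 0 1] this[of 1 0] this[of 1 1]
  show "a = a' \<and> b = b' \<and> c = c' \<and> d = d'"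
    by (simp add: mat2_eq_mat)
qed simp

lemma mat2_exhaust:
  assumes "A \<in> carrier_mat 2 2"
  obtains a b c d where "A = mat2 a b c d"
proof
  show "A = mat2 (A $$ (0, 0)) (A $$ (0, 1)) (A $$ (1, 0)) (A $$ (1, 1))"
    using assms by (intro eq_matI) (auto simp: mat2_eq_mat dest!: less_2_cases)
qed

lemma mat2_mult [simp]:
  fixes a b c d :: "'a :: semiring_1"
  shows "mat2 a b c d * mat2 a' b' c' d' =
    mat2 (a * a' + b * c') (a * b' + b * d') (c * a' + d * c') (c * b' + d * d')"
proof -
  have "{0..<2} = {0, 1 :: nat}" by auto
  then show ?thesis
    by (intro eq_matI) (auto simp: mat2_eq_mat scalar_prod_def)
qed

lemma mat2_add [simp]:
  fixes a b c d :: "'a :: semiring_1"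
  shows "mat2 a b c d + mat2 a' b' c' d' = mat2 (a + a') (b + b') (c + c') (d + d')"
  by (rule eq_matI) (auto simp: mat2_eq_mat)

lemma one_mat_2: "1\<^sub>m 2 = mat2 1 0 0 1"
  by (rule eq_matI) (auto simp: mat2_eq_mat dest!: less_2_cases)

lemma zero_mat_2: "0\<^sub>m 2 2 = mat2 0 0 0 0"
  by (rule eq_matI) (auto simp: mat2_eq_mat)

section \<open>Powers and similarity\<close>

lemma pow_mat_add:
  assumes "A \<in> carrier_mat n n"
  shows "A ^\<^sub>m (i + j) = A ^\<^sub>m i * A ^\<^sub>m j"
proof (induction j)
  case 0
  then show ?case using assms by (simp add: right_mult_one_mat[where nr = n])
next
  case (Suc j)
  have "A ^\<^sub>m l \<in> carrier_mat n n" for l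
    using assms by simp
  from assoc_mult_mat[OF this this assms] show ?case using Suc by simp
qed

lemma pow_mat_2:
  assumes "A \<in> carrier_mat n n"
  shows "A ^\<^sub>m 2 = A * A"
  using assms by (simp add: numeral_2_eq_2)

lemma pow_mat_4:
  assumes "A \<in> carrier_mat n n"
  shows "A ^\<^sub>m 4 = A * A * (A * A)"
  using pow_mat_add[OF assms, of 2 2] pow_mat_2[OF assms] by simp

lemma pow_mat_mult:
  assumes "A \<in> carrier_mat n n"
  shows "A ^\<^sub>m (i * j) = (A ^\<^sub>m i) ^\<^sub>m j"
proof (induction j)
  case (Suc j)
  have "A ^\<^sub>m (i * Suc j) = A ^\<^sub>m (i * j + i)" by (simp add: add.commute)
  with Suc show ?case by (simp only: pow_mat_add[OF assms] pow_mat.simps)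
qed (use assms in simp)

lemma pow_mat_periodic:
  assumes A: "A \<in> carrier_mat n n" and per: "A ^\<^sub>m Suc m = A" and i: "i mod m = 1 mod m" "i > 0"
  shows "A ^\<^sub>m i = A"
proof -
  have *: "A ^\<^sub>m (m * q + 1) = A" for q
  proof (induction q)
    case 0
    show ?case using A by simp
  next
    case (Suc q)
    have "A ^\<^sub>m (m * Suc q + 1) = A ^\<^sub>m ((m * q + 1) + m)" by (simp add: algebra_simps)
    \<comment> \<open>The first factor collapses to \<open>A\<close> by induction, and the remaining
      \<open>A * A ^\<^sub>m m\<close> is a power again.\<close>
    also have "\<dots> = A ^\<^sub>m Suc m"
      using pow_mat_add[OF A, of 1 m] A by (subst pow_mat_add[OF A]) (simp only: Suc, simp)
    finally show ?case using per by simp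
  qed
  have "m dvd i - 1" using i mod_eq_dvd_iff_nat[of 1 i m] by simp
  then obtain q where "i - 1 = m * q" by (auto elim: dvdE)
  then have "i = m * q + 1" using i(2) by linarith
  then show ?thesis using * by simp
qed

text \<open>Conjugation by an invertible matrix is additive and commutes with taking powers.\<close>

lemma sums_of_two_powers_similar:
  assumes "A \<in> sums_of_two_powers n k" and "similar_mat B A"
  shows "B \<in> sums_of_two_powers n k"
proof -
  from assms(1) obtain X Y where XY: "X \<in> carrier_mat n n" "Y \<in> carrier_mat n n"
    and A: "A = X ^\<^sub>m k + Y ^\<^sub>m k"
    by (auto simp: sums_of_two_powers_def)
  have An: "A \<in> carrier_mat n n" using XY A by simp
  from assms(2) obtain S T where "similar_mat_wit B A S T" by (auto simp: similar_mat_def)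
  moreover have "dim_row B = n"
    using similar_mat_witD(5)[OF refl calculation] An by auto
  ultimately have w: "S * T = 1\<^sub>m n" "T * S = 1\<^sub>m n" "B = S * A * T"
    "S \<in> carrier_mat n n" "T \<in> carrier_mat n n"
    using similar_mat_witD[of n B A S T] by auto
  have conj: "S * Z ^\<^sub>m k * T = (S * Z * T) ^\<^sub>m k" if "Z \<in> carrier_mat n n" for Z
    using w that by (intro similar_mat_wit_pow_id [symmetric] similar_mat_witI[where n = n]) auto
  have pc: "X ^\<^sub>m k \<in> carrier_mat n n" "Y ^\<^sub>m k \<in> carrier_mat n n" using XY by auto
  have "B = S * X ^\<^sub>m k * T + S * Y ^\<^sub>m k * T"
    unfolding w(3) A mult_add_distrib_mat[OF w(4) pc]
    using pc w(4,5) by (intro add_mult_distrib_mat[where nr = n]) auto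
  then have "B = (S * X * T) ^\<^sub>m k + (S * Y * T) ^\<^sub>m k" using conj XY by simp
  moreover have "S * X * T \<in> carrier_mat n n" "S * Y * T \<in> carrier_mat n n"
    using w(4,5) XY by auto
  ultimately show ?thesis unfolding sums_of_two_powers_def by blast
qed

section \<open>Companion matrices and nilpotency\<close>

text \<open>The companion matrix of x^2 - t x + \<delta>, with trace t and determinant
  \<delta>.\<close>

abbreviation companion2 :: "'a :: field \<Rightarrow> 'a \<Rightarrow> 'a mat" where
  "companion2 t \<delta> \<equiv> mat2 0 (- \<delta>) 1 t"

text \<open>An intertwining relation AS = SB with S invertible is a similarity; in this form no
  application has to compute the inverse of S.\<close>

lemma similar_mat2I:
  fixes A :: "'a :: field mat"
  assumes A: "A \<in> carrier_mat 2 2" "B \<in> carrier_mat 2 2"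
    and comm: "A * mat2 p q r s = mat2 p q r s * B" and det: "p * s - q * r \<noteq> 0"
  shows "similar_mat A B"
proof -
  define D where "D = p * s - q * r"
  define S where "S = mat2 p q r s"
  \<comment> \<open>The adjugate of \<open>S\<close> divided by its determinant.\<close>
  define T where "T = mat2 (s / D) (- q / D) (- r / D) (p / D)"
  have D: "D \<noteq> 0" using det by (simp add: D_def)
  have ST: "S * T = 1\<^sub>m 2" "T * S = 1\<^sub>m 2"
    using D by (simp_all add: S_def T_def one_mat_2 divide_simps) (simp_all add: D_def algebra_simps)
  have [simp]: "S \<in> carrier_mat 2 2" "T \<in> carrier_mat 2 2" by (simp_all add: S_def T_def)
  have "S * B * T = A * S * T" using comm by (simp add: S_def)
  also have "\<dots> = A" using A ST assoc_mult_mat[of A 2 2 S 2 T 2] by simp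
  finally have "similar_mat_wit A B S T"
    using ST A by (intro similar_mat_witI[where n = 2]) auto
  then show ?thesis by (auto simp: similar_mat_def)
qed

text \<open>The columns of the transition matrix are v and Av, for a vector v that is not an eigenvector:
  a standard basis vector or, for diagonal A, their sum.\<close>

lemma similar_companion2:
  fixes a b c d :: "'a :: field"
  assumes "\<not> (b = 0 \<and> c = 0 \<and> a = d)"
  shows "similar_mat (mat2 a b c d) (companion2 (a + d) (a * d - b * c))"
proof (cases "c = 0")
  case False
  then show ?thesis
    by (intro similar_mat2I[where p = 1 and r = 0 and q = a and s = c]) (simp_all add: algebra_simps)
next
  case c: True
  show ?thesis
  proof (cases "b = 0")
    case False
    then show ?thesis
      by (intro similar_mat2I[where p = 0 and r = 1 and q = b and s = d]) (simp_all add: algebra_simps)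
  next
    case True
    then show ?thesis using c assms
      by (intro similar_mat2I[where p = 1 and r = 1 and q = a and s = d]) (simp_all add: algebra_simps)
  qed
qed

lemma mat2_pow_det:
  fixes a b c d :: "'a :: field"
  shows "\<exists>x y z w. mat2 a b c d ^\<^sub>m n = mat2 x y z w \<and> x * w - y * z = (a * d - b * c) ^ n"
proof (induction n)
  case (Suc n)
  then obtain x y z w where IH: "mat2 a b c d ^\<^sub>m n = mat2 x y z w"
    "x * w - y * z = (a * d - b * c) ^ n" by blast
  \<comment> \<open>Multiplicativity of the determinant, written out in entries.\<close>
  have "(x * a + y * c) * (z * b + w * d) - (x * b + y * d) * (z * a + w * c)
      = (a * d - b * c) * (x * w - y * z)" by (simp add: algebra_simps)
  then show ?case by (simp add: IH)
qed (simp add: one_mat_2)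

text \<open>By Cayley-Hamilton, determinant 0 gives A^2 = tr(A) A, so each further factor
  contributes one trace.\<close>

lemma mat2_pow_singular:
  fixes a b c d :: "'a :: field"
  assumes "a * d = b * c"
  shows "mat2 a b c d ^\<^sub>m Suc n =
    mat2 ((a + d) ^ n * a) ((a + d) ^ n * b) ((a + d) ^ n * c) ((a + d) ^ n * d)"
proof (induction n)
  case (Suc n)
  have "x * a + y * c = (a + d) * x" "x * b + y * d = (a + d) * y"
    if "x = r * a" "y = r * b" for x y r
    using assms that by (simp_all add: algebra_simps)
  moreover have "x * a + y * c = (a + d) * x" "x * b + y * d = (a + d) * y"
    if "x = r * c" "y = r * d" for x y r
    using assms that by (simp_all add: algebra_simps)
  ultimately show ?case
    by (subst pow_mat.simps, subst Suc) (simp add: mult.assoc)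
qed (simp add: one_mat_2)

text \<open>If A^n = 0, the determinant vanishes, so A^(n+1) = tr(A)^n A; as A is nonzero, the trace
  vanishes too. Conversely, \<open>companion2 0 0\<close> is nonzero with square 0, and both
  properties pass along similarity.\<close>

lemma nilpotent_mat2_iff:
  fixes A :: "'a :: field mat"
  assumes "A \<in> carrier_mat 2 2"
  shows "nilpotent_mat A \<and> A \<noteq> 0\<^sub>m 2 2 \<longleftrightarrow> similar_mat A (companion2 0 0)"
proof
  obtain a b c d where A: "A = mat2 a b c d" using assms by (rule mat2_exhaust)
  assume nil: "nilpotent_mat A \<and> A \<noteq> 0\<^sub>m 2 2"
  then obtain n where n: "A ^\<^sub>m n = 0\<^sub>m 2 2" using assms by (auto simp: nilpotent_mat_def)
  from mat2_pow_det[of a b c d n] have "(a * d - b * c) ^ n = 0"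
    using n by (auto simp: A zero_mat_2)
  then have det: "a * d = b * c" by simp
  have "A ^\<^sub>m Suc n = 0\<^sub>m 2 2" using n assms by simp
  then have tr: "a + d = 0"
    using nil det by (auto simp: A mat2_pow_singular zero_mat_2 simp del: pow_mat.simps)
  \<comment> \<open>A scalar matrix of determinant 0 would be 0.\<close>
  have "\<not> (b = 0 \<and> c = 0 \<and> a = d)"
    using nil det by (auto simp: A zero_mat_2)
  from similar_companion2[OF this] show "similar_mat A (companion2 0 0)"
    by (simp add: A det tr)
next
  assume "similar_mat A (companion2 0 0)"
  then obtain S T where w: "similar_mat_wit A (companion2 0 0) S T" by (auto simp: similar_mat_def)
  have ST: "S \<in> carrier_mat 2 2" "T \<in> carrier_mat 2 2"
    using similar_mat_witD2[OF assms w] by auto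
  have "A ^\<^sub>m 2 = S * (companion2 0 0) ^\<^sub>m 2 * T" using similar_mat_wit_pow_id[OF w] .
  also have "(companion2 0 0) ^\<^sub>m 2 = (0\<^sub>m 2 2 :: 'a mat)" by (simp add: zero_mat_2 pow_mat_2[where n = 2])
  also have "S * \<dots> * T = 0\<^sub>m 2 2" using ST by simp
  finally have "nilpotent_mat A" using assms by (auto simp: nilpotent_mat_def)
  moreover have "A \<noteq> 0\<^sub>m 2 2"
  proof
    assume "A = 0\<^sub>m 2 2"
    then have "companion2 0 0 = (0\<^sub>m 2 2 :: 'a mat)"
      using similar_mat_witD(3)[OF refl similar_mat_wit_sym[OF w]] ST by simp
    then show False by (simp add: zero_mat_2)
  qed
  ultimately show "nilpotent_mat A \<and> A \<noteq> 0\<^sub>m 2 2" ..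
qed

section \<open>The field with three elements\<close>

text \<open>Only the cardinality is given, so characteristic 3 has to be derived. The first seven
  facts serve as rewrite rules that decide arithmetic on numerals.\<close>

lemma card_3_field:
  assumes "CARD('f :: field) = 3"
  shows "(3 :: 'f) = 0" "(4 :: 'f) = 1" "(- 1 :: 'f) = 2" "(- 2 :: 'f) = 1"
    "(2 :: 'f) \<noteq> 0" "(2 :: 'f) \<noteq> 1" "(1 :: 'f) \<noteq> 2" "(x :: 'f) = 0 \<or> x = 1 \<or> x = 2"
proof -
  have fin: "finite (UNIV :: 'f set)" using assms by (simp add: card_ge_0_finite)
  \<comment> \<open>Translation by 1 permutes the field, so the sum of all elements is unchanged,
    although it grows by 1 for each of the three elements.\<close>
  have "(\<Sum>x\<in>(UNIV :: 'f set). x) = (\<Sum>x\<in>UNIV. x + 1)"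
    by (rule sum.reindex_bij_witness[of _ "\<lambda>x. x + 1" "\<lambda>x. x - 1"]) auto
  also have "\<dots> = (\<Sum>x\<in>UNIV. x) + 3" using assms fin by (simp add: sum.distrib)
  finally show three: "(3 :: 'f) = 0" by simp
  have "(4 :: 'f) = 3 + 1" "(- 1 :: 'f) = 2 - 3" "(- 2 :: 'f) = 1 - 3" by simp_all
  then show "(4 :: 'f) = 1" and neg: "(- 1 :: 'f) = 2" "(- 2 :: 'f) = 1"
    unfolding three by simp_all
  show neq: "(2 :: 'f) \<noteq> 0" using neg(1) by (metis neg_equal_0_iff_equal zero_neq_one)
  show "(2 :: 'f) \<noteq> 1"
    by (metis add_cancel_right_right one_add_one zero_neq_one)
  then show "(1 :: 'f) \<noteq> 2" by (rule not_sym)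
  have "card {0, 1, 2 :: 'f} = CARD('f)" using neq \<open>(2 :: 'f) \<noteq> 1\<close> \<open>(1 :: 'f) \<noteq> 2\<close> assms by simp
  then have "{0, 1, 2 :: 'f} = UNIV" using fin by (metis card_subset_eq subset_UNIV)
  then show "x = 0 \<or> x = 1 \<or> x = 2" by blast
qed

lemma all_card_3_field:
  assumes "CARD('f :: field) = 3"
  shows "(\<forall>x :: 'f. Q x) \<longleftrightarrow> Q 0 \<and> Q 1 \<and> Q 2"
  using card_3_field(8)[OF assms] by metis

text \<open>A singular A has A^6 = tr(A)^5 A, which is 0 or an idempotent of trace 1. An invertible
  A has order 1, 2, 3, 4, 6 or 8; its sixth power is 1 or -1 except for order 8, where it has order
  4, hence trace 0 and determinant 1. The proof checks all 81 matrices.\<close>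

lemma sixth_power_mat2:
  assumes F3: "CARD('f :: field) = 3"
    and pow: "mat2 a b c (d :: 'f) = A ^\<^sub>m 6" and A: "A \<in> carrier_mat 2 2"
  shows "(b = 0 \<and> c = 0 \<and> a = d) \<or> (a + d = 1 \<and> a * d = b * c) \<or> (a + d = 0 \<and> a * d - b * c = 1)"
proof -
  obtain p q r s where pqrs: "A = mat2 p q r s" using A by (rule mat2_exhaust)
  have "A ^\<^sub>m 6 = A * A * (A * A * (A * A))"
    using pow_mat_add[OF A, of 2 4] pow_mat_add[OF A, of 2 2] pow_mat_2[OF A] by simp
  with pow have pow: "mat2 a b c d = A * A * (A * A * (A * A))" by simp
  show ?thesis
    using card_3_field(8)[OF F3, of p] card_3_field(8)[OF F3, of q]
      card_3_field(8)[OF F3, of r] card_3_field(8)[OF F3, of s]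
    by (elim disjE; insert pow; unfold pqrs; hypsubst; simp add: card_3_field(1-7)[OF F3])
qed

text \<open>By Cayley-Hamilton, trace 1 and determinant 0 make a matrix idempotent, while trace 0
  and determinant 1 make its square equal to -1, a scalar. So squaring removes the third
  alternative.\<close>

lemma square_mat2:
  fixes a b c d :: "'a :: field"
  assumes "(b = 0 \<and> c = 0 \<and> a = d) \<or> (a + d = 1 \<and> a * d = b * c) \<or> (a + d = 0 \<and> a * d - b * c = 1)"
    and "mat2 x y z w = mat2 a b c d ^\<^sub>m 2"
  shows "(y = 0 \<and> z = 0 \<and> x = w) \<or> (x + w = 1 \<and> x * w = y * z)"
proof -
  have xyzw: "x = a * a + b * c" "y = b * (a + d)" "z = c * (a + d)" "w = c * b + d * d"
    using assms(2) by (simp_all add: pow_mat_2[where n = 2] algebra_simps)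
  from assms(1) consider "b = 0" "c = 0" "a = d" | "a + d = 1" "b * c = a * d"
    | "a + d = 0" "a * d - b * c = 1" by metis
  then show ?thesis
  proof cases
    case 1
    then show ?thesis by (simp add: xyzw)
  next
    case 2
    have "x = a * (a + d)" "w = d * (a + d)"
      using 2(2) by (simp_all add: xyzw algebra_simps)
    then have "x = a" "w = d" "y = b" "z = c" using 2(1) xyzw by simp_all
    then show ?thesis using 2 by simp
  next
    case 3
    then have "d = - a" by (metis add.inverse_unique)
    then show ?thesis using 3 by (simp add: xyzw)
  qed
qed

section \<open>Sums of two powers\<close>

lemma sums_of_two_powersI:
  assumes "X \<in> (\<lambda>Z. Z ^\<^sub>m k) ` carrier_mat n n" "Y \<in> (\<lambda>Z. Z ^\<^sub>m k) ` carrier_mat n n" "A = X + Y"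
  shows "A \<in> sums_of_two_powers n k"
  using assms by (auto simp: sums_of_two_powers_def)

text \<open>The matrix \<open>X ^\<^sub>m k\<close> is a k-th root of \<open>X\<close>, because k is
  its own inverse modulo m. For m = 1, 2, 3, 4 this holds for every k coprime to m.\<close>

lemma periodic_mem_powers:
  assumes X: "X \<in> carrier_mat n n" and "X ^\<^sub>m Suc m = X" "k * k mod m = 1 mod m" "k > 0"
  shows "X \<in> (\<lambda>Z. Z ^\<^sub>m k) ` carrier_mat n n"
proof
  show "X = (X ^\<^sub>m k) ^\<^sub>m k"
    using assms pow_mat_periodic[OF X, of m "k * k"] by (simp add: pow_mat_mult[OF X])
qed (use X in simp)

lemma idempotent_mem_powers:
  assumes "X \<in> carrier_mat n n" "X * X = X" "k > 0"
  shows "X \<in> (\<lambda>Z. Z ^\<^sub>m k) ` carrier_mat n n"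
  using assms by (intro periodic_mem_powers[where m = 1]) simp_all

lemma odd_square_mod_8:
  assumes "odd (j :: nat)"
  shows "j * j mod 8 = 1"
proof -
  obtain i where i: "j = 2 * i + 1" using assms by (rule oddE)
  have "even (i * (i + 1))" by simp
  then obtain m where "i * (i + 1) = 2 * m" by (rule evenE)
  then have "j * j = 8 * m + 1" by (simp add: i algebra_simps)
  then show ?thesis by simp
qed

lemma square_mod_3:
  assumes "\<not> 3 dvd (k :: nat)"
  shows "k * k mod 3 = 1 mod 3"
proof -
  have "k mod 3 = 1 \<or> k mod 3 = 2" using assms by presburger
  then show ?thesis using mod_mult_eq[of k 3 k] by (elim disjE) simp_all
qed

text \<open>The matrix J = \<open>mat2 0 2 1 0\<close> satisfies J^2 = -1 and has order 4, which
  settles odd k. For k = 2j with j odd, J = Y^2 with Y of order 8, and j^2 is 1 modulo 8, so Y^j is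
  a k-th root of J.\<close>

lemma order_4_mem_powers:
  assumes F3: "CARD('f :: field) = 3" and "\<not> 4 dvd k"
  shows "mat2 0 2 1 (0 :: 'f) \<in> (\<lambda>Z. Z ^\<^sub>m k) ` carrier_mat 2 2"
proof (cases "even k")
  case False
  show ?thesis
  proof (rule periodic_mem_powers[where m = 4])
    show "mat2 0 2 1 (0 :: 'f) ^\<^sub>m Suc 4 = mat2 0 2 1 0"
      by (simp only: pow_mat.simps pow_mat_4[OF mat2_carrier]) (simp add: card_3_field(1-7)[OF F3])
    show "k * k mod 4 = 1 mod 4"
      using odd_square_mod_8[OF False] mod_mod_cancel[of 4 8 "k * k"] by simp
    show "k > 0" using False by (cases k) auto
  qed simp
next
  case True
  then obtain j where j: "k = 2 * j" by blast
  have "odd j" using assms(2) unfolding j by presburger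
  \<comment> \<open>A square root of J, which therefore has order 8.\<close>
  define Y where "Y = mat2 1 1 2 (1 :: 'f)"
  have Y: "Y \<in> carrier_mat 2 2" by (simp add: Y_def)
  have Y2: "Y ^\<^sub>m 2 = mat2 0 2 1 0"
    by (simp add: Y_def pow_mat_2[where n = 2] card_3_field(1-7)[OF F3])
  have "Y ^\<^sub>m 8 = (Y ^\<^sub>m 2) ^\<^sub>m 4" using pow_mat_mult[OF Y, of 2 4] by simp
  also have "\<dots> = mat2 1 0 0 1"
    by (simp add: Y2 pow_mat_4[where n = 2] card_3_field(1-7)[OF F3])
  finally have per: "Y ^\<^sub>m Suc 8 = Y"
    by (simp only: pow_mat.simps) (simp add: Y_def)
  have "j * j mod 8 = 1 mod 8" using odd_square_mod_8[OF \<open>odd j\<close>] by simp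
  moreover have "j * j > 0" using odd_pos[OF \<open>odd j\<close>] by simp
  ultimately have jj: "Y ^\<^sub>m (j * j) = Y" by (rule pow_mat_periodic[OF Y per])
  have "(Y ^\<^sub>m j) ^\<^sub>m k = Y ^\<^sub>m (j * k)" by (rule pow_mat_mult[OF Y, symmetric])
  also have "j * k = j * j * 2" by (simp add: j)
  also have "Y ^\<^sub>m \<dots> = mat2 0 2 1 0" by (simp only: pow_mat_mult[OF Y, of "j * j" 2] jj Y2)
  finally have "(Y ^\<^sub>m j) ^\<^sub>m k = mat2 0 2 1 0" .
  then show ?thesis using Y by (intro image_eqI[of _ _ "Y ^\<^sub>m j"]) auto
qed

section \<open>Representing scalar and companion matrices\<close>

lemma scalar_mem_sums_of_two_powers:
  assumes F3: "CARD('f :: field) = 3" and k: "k > 0"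
  shows "mat2 a 0 0 (a :: 'f) \<in> sums_of_two_powers 2 k"
proof -
  note idem = idempotent_mem_powers[OF mat2_carrier _ k]
  consider "a = 0" | "a = 1" | "a = 2" using card_3_field(8)[OF F3] by blast
  then show ?thesis
  proof cases
    case 1
    then show ?thesis
      by (intro sums_of_two_powersI[OF idem[of 0 0 0 0] idem[of 0 0 0 0]]) simp_all
  next
    case 2
    then show ?thesis
      by (intro sums_of_two_powersI[OF idem[of 1 0 0 1] idem[of 0 0 0 0]]) simp_all
  next
    case 3
    then show ?thesis
      by (intro sums_of_two_powersI[OF idem[of 1 0 0 1] idem[of 1 0 0 1]]) simp_all
  qed
qed

lemma companion2_mem_idempotents:
  assumes F3: "CARD('f :: field) = 3" and k: "k > 0"
  shows "companion2 (2 :: 'f) \<delta> \<in> sums_of_two_powers 2 k"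
    and "companion2 (1 :: 'f) 0 \<in> sums_of_two_powers 2 k"
    and "companion2 (0 :: 'f) 2 \<in> sums_of_two_powers 2 k"
proof -
  note idem = idempotent_mem_powers[OF mat2_carrier _ k]
  note arith = card_3_field(1-7)[OF F3]
  show "companion2 (2 :: 'f) \<delta> \<in> sums_of_two_powers 2 k"
    by (rule sums_of_two_powersI[OF idem[of 0 0 1 1] idem[of 0 "-\<delta>" 0 1]]) simp_all
  show "companion2 (1 :: 'f) 0 \<in> sums_of_two_powers 2 k"
    by (rule sums_of_two_powersI[OF idem[of 0 0 1 1] idem[of 0 0 0 0]]) simp_all
  \<comment> \<open>Subtracting the identity from this matrix leaves trace 1 and determinant 0,
    hence an idempotent.\<close>
  show "companion2 (0 :: 'f) 2 \<in> sums_of_two_powers 2 k"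
    by (rule sums_of_two_powersI[OF idem[of 1 0 0 1] idem[of 2 1 1 2]]) (simp_all add: arith)
qed

text \<open>Either 4 does not divide k, and J of order 4 plus an idempotent gives all three
  matrices, or 3 does not divide k, and elements of order 3 are available as k-th powers.\<close>

lemma companion2_mem_not_12_dvd:
  assumes F3: "CARD('f :: field) = 3" and k: "\<not> 12 dvd k"
  shows "companion2 (1 :: 'f) 1 \<in> sums_of_two_powers 2 k"
    and "companion2 (0 :: 'f) 1 \<in> sums_of_two_powers 2 k"
    and "companion2 (1 :: 'f) 2 \<in> sums_of_two_powers 2 k"
proof -
  have pos: "k > 0" using k by (cases k) auto
  note idem = idempotent_mem_powers[OF mat2_carrier _ pos]
  note arith = card_3_field(1-7)[OF F3]
  have "companion2 (1 :: 'f) 1 \<in> sums_of_two_powers 2 k \<and>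
    companion2 (0 :: 'f) 1 \<in> sums_of_two_powers 2 k \<and> companion2 (1 :: 'f) 2 \<in> sums_of_two_powers 2 k"
  proof (cases "4 dvd k")
    case False
    note J = order_4_mem_powers[OF F3 False]
    show ?thesis
      by (intro conjI sums_of_two_powersI[OF idem[of 0 0 0 1] J] sums_of_two_powersI[OF idem[of 0 0 0 0] J]
          sums_of_two_powersI[OF idem[of 0 2 0 1] J]) (simp_all add: arith)
  next
    case True
    with k have "\<not> 3 dvd k" by presburger
    note per = periodic_mem_powers[OF mat2_carrier _ square_mod_3[OF this] pos]
    \<comment> \<open>All four have trace 2 and determinant 1, so (U - 1)^2 = 0 and, in
      characteristic 3, U^3 = 1. The first is the negative of \<open>companion2 1 1\<close>, so its
      double is that matrix.\<close>
    have U: "mat2 0 1 2 (2 :: 'f) \<in> (\<lambda>Z. Z ^\<^sub>m k) ` carrier_mat 2 2"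
      "mat2 0 2 1 (2 :: 'f) \<in> (\<lambda>Z. Z ^\<^sub>m k) ` carrier_mat 2 2"
      "mat2 1 2 0 (1 :: 'f) \<in> (\<lambda>Z. Z ^\<^sub>m k) ` carrier_mat 2 2"
      "mat2 2 2 1 (0 :: 'f) \<in> (\<lambda>Z. Z ^\<^sub>m k) ` carrier_mat 2 2"
      by (rule per, simp add: pow_mat_4[where n = 2] arith)+
    show ?thesis
      by (intro conjI sums_of_two_powersI[OF U(1) U(1)] sums_of_two_powersI[OF idem[of 0 0 0 1] U(2)]
          sums_of_two_powersI[OF U(3) U(4)]) (simp_all add: arith)
  qed
  then show "companion2 (1 :: 'f) 1 \<in> sums_of_two_powers 2 k"
    "companion2 (0 :: 'f) 1 \<in> sums_of_two_powers 2 k" "companion2 (1 :: 'f) 2 \<in> sums_of_two_powers 2 k"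
    by auto
qed

text \<open>An idempotent of trace 1 is combined with a k-th power of trace 2: the negative of an
  idempotent if k is odd, an element of order 3 if 3 does not divide k.\<close>

lemma companion2_mem_not_6_dvd:
  assumes F3: "CARD('f :: field) = 3" and k: "\<not> 6 dvd k"
  shows "companion2 (0 :: 'f) 0 \<in> sums_of_two_powers 2 k"
proof -
  have pos: "k > 0" using k by (cases k) auto
  note idem = idempotent_mem_powers[OF mat2_carrier _ pos]
  note arith = card_3_field(1-7)[OF F3]
  show ?thesis
  proof (cases "even k")
    case False
    then have "k * k mod 2 = 1 mod 2" by (simp add: mod_2_eq_odd)
    note per = periodic_mem_powers[OF mat2_carrier _ this pos]
    \<comment> \<open>This U is the negative of an idempotent, so U^3 = U.\<close>
    have U: "mat2 0 0 0 (2 :: 'f) \<in> (\<lambda>Z. Z ^\<^sub>m k) ` carrier_mat 2 2"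
      by (rule per) (simp only: pow_mat.simps pow_mat_2[OF mat2_carrier], simp add: arith)
    show ?thesis
      by (rule sums_of_two_powersI[OF idem[of 0 0 1 1] U]) (simp_all add: arith)
  next
    case True
    with k have "\<not> 3 dvd k" by presburger
    note per = periodic_mem_powers[OF mat2_carrier _ square_mod_3[OF this] pos]
    have U: "mat2 0 2 1 (2 :: 'f) \<in> (\<lambda>Z. Z ^\<^sub>m k) ` carrier_mat 2 2"
      by (rule per) (simp add: pow_mat_4[where n = 2] arith)
    show ?thesis
      by (rule sums_of_two_powersI[OF idem[of 0 1 0 1] U]) (simp_all add: arith)
  qed
qed

section \<open>Obstructions when 6 or 12 divides the exponent\<close>

lemma power_6_dvd_shape:
  assumes F3: "CARD('f :: field) = 3" and "6 dvd k" and A: "A \<in> carrier_mat 2 2"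
    and pow: "A ^\<^sub>m k = mat2 a b c (d :: 'f)"
  shows "(b = 0 \<and> c = 0 \<and> a = d) \<or> (a + d = 1 \<and> a * d = b * c) \<or> (a + d = 0 \<and> a * d - b * c = 1)"
proof -
  obtain j where "k = j * 6" using assms(2) by (auto elim: dvdE)
  then have "mat2 a b c d = (A ^\<^sub>m j) ^\<^sub>m 6" using pow by (simp add: pow_mat_mult[OF A])
  then show ?thesis using A by (intro sixth_power_mat2[OF F3, of a b c d "A ^\<^sub>m j"]) auto
qed

lemma power_12_dvd_shape:
  assumes F3: "CARD('f :: field) = 3" and "12 dvd k" and A: "A \<in> carrier_mat 2 2"
    and pow: "A ^\<^sub>m k = mat2 a b c (d :: 'f)"
  shows "(b = 0 \<and> c = 0 \<and> a = d) \<or> (a + d = 1 \<and> a * d = b * c)"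
proof -
  \<comment> \<open>The factor 2 comes last, so that the k-th power is the square of a matrix of the
    shape known for multiples of 6.\<close>
  obtain j where k: "k = (6 * j) * 2" using assms(2) by (auto elim: dvdE)
  have "A ^\<^sub>m (6 * j) \<in> carrier_mat 2 2" using A by simp
  then obtain x y z w where xyzw: "A ^\<^sub>m (6 * j) = mat2 x y z w" by (rule mat2_exhaust)
  have "mat2 a b c d = mat2 x y z w ^\<^sub>m 2"
    using pow by (simp only: k pow_mat_mult[OF A, of "6 * j" 2] xyzw)
  with power_6_dvd_shape[OF F3 _ A xyzw] show ?thesis
    by (intro square_mat2[of y z x w]) auto
qed

text \<open>Writing the second power as a difference leaves only four field elements unknown, so
  nonmembership becomes a check of 81 cases.\<close>

lemma sums_of_two_powers_mat2E:
  assumes "mat2 p q r s \<in> sums_of_two_powers 2 k"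
  obtains X Y a b c d where "X \<in> carrier_mat 2 2" "Y \<in> carrier_mat 2 2"
    "X ^\<^sub>m k = mat2 a b c (d :: 'f :: field)" "Y ^\<^sub>m k = mat2 (p - a) (q - b) (r - c) (s - d)"
proof -
  from assms obtain X Y where XY: "X \<in> carrier_mat 2 2" "Y \<in> carrier_mat 2 2"
    and sum: "mat2 p q r s = X ^\<^sub>m k + Y ^\<^sub>m k"
    by (auto simp: sums_of_two_powers_def)
  then have "X ^\<^sub>m k \<in> carrier_mat 2 2" "Y ^\<^sub>m k \<in> carrier_mat 2 2" by auto
  then obtain a b c d a' b' c' d' where *: "X ^\<^sub>m k = mat2 a b c d" "Y ^\<^sub>m k = mat2 a' b' c' d'"
    by (metis mat2_exhaust)
  show thesis
    by (rule that[OF XY *(1)]) (use sum * in auto)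
qed

text \<open>Comparing traces, a nonscalar sum of trace 0 would be 0 or a second matrix of trace 0
  and determinant 1 added to one such matrix, or the identity plus an idempotent of trace 1. The
  first and last are not nilpotent, and the second would make -1 a square in the field.\<close>

lemma companion2_not_mem_6_dvd:
  assumes F3: "CARD('f :: field) = 3" and k: "6 dvd k"
  shows "companion2 (0 :: 'f) 0 \<notin> sums_of_two_powers 2 k"
proof
  assume "companion2 (0 :: 'f) 0 \<in> sums_of_two_powers 2 k"
  then obtain X Y a b c d where XY: "X \<in> carrier_mat 2 2" "Y \<in> carrier_mat 2 2"
    "X ^\<^sub>m k = mat2 a b c (d :: 'f)" "Y ^\<^sub>m k = mat2 (0 - a) (- 0 - b) (1 - c) (0 - d)"
    by (rule sums_of_two_powers_mat2E)
  have "\<forall>a b c d :: 'f.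
      (b = 0 \<and> c = 0 \<and> a = d) \<or> (a + d = 1 \<and> a * d = b * c) \<or> (a + d = 0 \<and> a * d - b * c = 1) \<longrightarrow>
      \<not> ((- 0 - b = 0 \<and> 1 - c = 0 \<and> 0 - a = 0 - d) \<or>
        (0 - a + (0 - d) = 1 \<and> (0 - a) * (0 - d) = (- 0 - b) * (1 - c)) \<or>
        (0 - a + (0 - d) = 0 \<and> (0 - a) * (0 - d) - (- 0 - b) * (1 - c) = 1))"
    by (simp add: all_card_3_field[OF F3] card_3_field(1-7)[OF F3])
  then show False
    using power_6_dvd_shape[OF F3 k XY(1,3)] power_6_dvd_shape[OF F3 k XY(2,4)] by blast
qed

text \<open>Two idempotents of trace 1 have a sum of trace 2. A scalar plus one such idempotent has
  trace and determinant (1, 0), (0, 2) or (2, 0), and two scalars add up to a scalar. None of the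
  three listed pairs is reached.\<close>

lemma companion2_not_mem_12_dvd:
  assumes F3: "CARD('f :: field) = 3" and k: "12 dvd k"
    and t\<delta>: "(t, \<delta>) \<in> {(1, 1), (0, 1), (1, 2 :: 'f)}"
  shows "companion2 t \<delta> \<notin> sums_of_two_powers 2 k"
proof
  assume "companion2 t \<delta> \<in> sums_of_two_powers 2 k"
  then obtain X Y a b c d where XY: "X \<in> carrier_mat 2 2" "Y \<in> carrier_mat 2 2"
    "X ^\<^sub>m k = mat2 a b c (d :: 'f)" "Y ^\<^sub>m k = mat2 (0 - a) (- \<delta> - b) (1 - c) (t - d)"
    by (rule sums_of_two_powers_mat2E)
  have "t = 1 \<and> \<delta> = 1 \<or> t = 0 \<and> \<delta> = 1 \<or> t = 1 \<and> \<delta> = 2" using t\<delta> by simp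
  then have "\<forall>a b c d :: 'f. (b = 0 \<and> c = 0 \<and> a = d) \<or> (a + d = 1 \<and> a * d = b * c) \<longrightarrow>
      \<not> ((- \<delta> - b = 0 \<and> 1 - c = 0 \<and> 0 - a = t - d) \<or>
        (0 - a + (t - d) = 1 \<and> (0 - a) * (t - d) = (- \<delta> - b) * (1 - c)))"
    by (elim disjE conjE) (simp_all add: all_card_3_field[OF F3] card_3_field(1-7)[OF F3]
        card_3_field(5)[OF F3, symmetric])
  then show False
    using power_12_dvd_shape[OF F3 k XY(1,3)] power_12_dvd_shape[OF F3 k XY(2,4)] by blast
qed

text \<open>Necessity transports the obstructions along similarity; sufficiency treats scalar
  matrices directly and replaces every other matrix by its companion matrix.\<close>

lemma mem_sums_of_two_powers_iff:
  fixes A :: "'f :: field mat"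
  assumes F3: "CARD('f) = 3" and k: "k > 0"
  shows "A \<in> sums_of_two_powers 2 k \<longleftrightarrow> A \<in> carrier_mat 2 2 \<and>
    (6 dvd k \<longrightarrow> \<not> similar_mat A (companion2 0 0)) \<and>
    (12 dvd k \<longrightarrow> \<not> similar_mat A (companion2 1 1) \<and> \<not> similar_mat A (companion2 0 1) \<and>
      \<not> similar_mat A (companion2 1 2))"
    (is "_ \<longleftrightarrow> _ \<and> ?C A")
proof (intro iffI conjI)
  assume A: "A \<in> sums_of_two_powers 2 k"
  then show "A \<in> carrier_mat 2 2" by (auto simp: sums_of_two_powers_def)
  have "\<not> similar_mat A B" if "B \<notin> sums_of_two_powers 2 k" for B
    using that A sums_of_two_powers_similar similar_mat_sym by blast
  then show "6 dvd k \<longrightarrow> \<not> similar_mat A (companion2 0 0)"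
    and "12 dvd k \<longrightarrow> \<not> similar_mat A (companion2 1 1) \<and> \<not> similar_mat A (companion2 0 1) \<and>
      \<not> similar_mat A (companion2 1 2)"
    using companion2_not_mem_6_dvd[OF F3] companion2_not_mem_12_dvd[OF F3] by simp_all
next
  assume A: "A \<in> carrier_mat 2 2 \<and> ?C A"
  then obtain a b c d where abcd: "A = mat2 a b c d" using mat2_exhaust by blast
  show "A \<in> sums_of_two_powers 2 k"
  proof (cases "b = 0 \<and> c = 0 \<and> a = d")
    case True
    then show ?thesis using scalar_mem_sums_of_two_powers[OF F3 k, of a] by (simp add: abcd)
  next
    case False
    define t \<delta> where "t = a + d" and "\<delta> = a * d - b * c"
    have sim: "similar_mat A (companion2 t \<delta>)"
      using similar_companion2[OF False] by (simp add: abcd t_def \<delta>_def)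
    \<comment> \<open>Of the nine pairs (t, \<delta>), five need only idempotents. For the other
      four, the assumed dissimilarity rules out that 12, or 6 for the pair (0, 0), divides
      k.\<close>
    have "companion2 t \<delta> \<in> sums_of_two_powers 2 k"
      using card_3_field(8)[OF F3, of t] card_3_field(8)[OF F3, of \<delta>]
      by (elim disjE; insert A sim companion2_mem_idempotents[OF F3 k] companion2_mem_not_12_dvd[OF F3, of k]
          companion2_mem_not_6_dvd[OF F3, of k]; hypsubst; blast)
    then show ?thesis using sim by (rule sums_of_two_powers_similar)
  qed
qed

theorem theorem7p2:
  fixes k :: nat
    and P C5 C9 C10 C12 :: "'f :: field mat set"
  assumes F3: "CARD('f) = 3"
    and k: "k \<ge> 2"
    and P: "P = sums_of_two_powers 2 k"
    and C5: "C5 = {A \<in> carrier_mat 2 2. nilpotent_mat A \<and> A \<noteq> 0\<^sub>m 2 2}"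
    and C9: "C9 = conj_class (mat2 2 1 0 2)"
    and C10: "C10 = conj_class (mat2 0 2 1 0)"
    and C12: "C12 = conj_class (mat2 0 1 1 1)"
  shows "(k mod 24 \<notin> {0, 6, 12, 18} \<longrightarrow> P = carrier_mat 2 2) \<and>
         (k mod 24 \<in> {6, 18} \<longrightarrow> P = carrier_mat 2 2 - C5) \<and>
         (k mod 12 = 0 \<longrightarrow> P = carrier_mat 2 2 - (C5 \<union> C9 \<union> C10 \<union> C12))"
proof -
  note arith = card_3_field(1-7)[OF F3]
  \<comment> \<open>Trace and determinant are 4 = 1. The representatives of \<open>C10\<close> and
    \<open>C12\<close> already are companion matrices, since -1 = 2 and -2 = 1.\<close>
  have "similar_mat (mat2 2 1 0 2) (companion2 1 (1 :: 'f))"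
    using similar_companion2[of 1 0 2 "2 :: 'f"] by (simp add: arith)
  then have "A \<in> C9 \<longleftrightarrow> similar_mat A (companion2 1 1)" for A
    unfolding C9 conj_class_def using similar_mat_trans similar_mat_sym by blast
  moreover have "A \<in> C10 \<longleftrightarrow> similar_mat A (companion2 0 1)"
    "A \<in> C12 \<longleftrightarrow> similar_mat A (companion2 1 2)" for A
    by (simp_all add: C10 C12 conj_class_def arith)
  moreover have "A \<in> C5 \<longleftrightarrow> A \<in> carrier_mat 2 2 \<and> similar_mat A (companion2 0 0)" for A
    using nilpotent_mat2_iff[of A] by (auto simp: C5)
  ultimately have mem: "A \<in> P \<longleftrightarrow> A \<in> carrier_mat 2 2 \<and> (6 dvd k \<longrightarrow> A \<notin> C5) \<and>
      (12 dvd k \<longrightarrow> A \<notin> C9 \<and> A \<notin> C10 \<and> A \<notin> C12)" for A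
    using mem_sums_of_two_powers_iff[OF F3, of k A] k by (auto simp: P)
  \<comment> \<open>The residues modulo 24 only record divisibility of k by 6 and by 12.\<close>
  have "k mod 24 \<notin> {0, 6, 12, 18} \<Longrightarrow> \<not> 6 dvd k \<and> \<not> 12 dvd k"
    "k mod 24 \<in> {6, 18} \<Longrightarrow> 6 dvd k \<and> \<not> 12 dvd k"
    "k mod 12 = 0 \<Longrightarrow> 6 dvd k \<and> 12 dvd k"
    unfolding insert_iff empty_iff by presburger+
  with mem show ?thesis by auto
qed

end
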